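(* Fix $\alpha>0$ and consider the Gamma exponential family $\Gamma(\alpha,\beta)$, $\beta>0$, with fixed shape parameter $\alpha$ and rate parameter $\beta$. (a) The CNML predictor equals Bayesian prediction based on Jeffreys' prior (density proportional to $1/\beta$ on $(0,\infty)$): for all $n>m\ge1$ and all sequences $x^n$ of positive numbers, $p^n_{cnml}(x_{m+1}^n\mid x^m)=p_\pi(x_{m+1}^n\mid x^m)$ with $\pi(\beta)=1/\beta$. The posterior distribution of $\beta$ after observing a sequence of length $m$ with average $\bar x$ is $\Gamma(m\alpha,m\bar x)$. (b) Let $F$ be the distribution function of $\Gamma(m\alpha,m)$ and let $\tilde\alpha\in(0,1)$. The interval $\left[0,F^{-1}(1-\tilde\alpha)/\bar x\right]$ is a $1-\tilde\alpha$ credible interval for $\beta$ (it has probability $1-\tilde\alpha$ under the posterior distribution $\Gamma(m\alpha,m\bar x)$), and it is also a $1-\tilde\alpha$ confidence interval for $\beta$: if $X_1,\dots,X_m$ are iid $\Gamma(\alpha,\beta)$ with average $\bar X$, then $P\left(\beta\in[0,F^{-1}(1-\tilde\alpha)/\bar X]\right)=1-\tilde\alpha$ for every $\beta>0$.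
   Context: $\Gamma(\alpha,\beta)$ denotes the Gamma distribution with shape $\alpha$ and rate $\beta$, with Lebesgue density $p_\beta(x)=\frac{\beta^\alpha x^{\alpha-1}}{\Gamma(\alpha)}\exp(-\beta x)$ for $x>0$. For sequences $p_\beta(x^n)=\prod_{i=1}^np_\beta(x_i)$, and $x_{m+1}^n=x_{m+1}\cdots x_n$. Let $\hat p(x^n)=\sup_{\beta>0}p_\beta(x^n)$ be the maximized likelihood. The CNML (conditional normalized maximum likelihood) predictor is $p^n_{cnml}(x_{m+1}^n\mid x^m)=\hat p(x^n)\big/\int_{(0,\infty)^{n-m}}\hat p(x^my^{n-m})\,\mathrm dy^{n-m}$. The Bayesian predictor with (possibly non-normalizable) prior density $\pi$ is $p_\pi(x_{m+1}^n\mid x^m)=\int_0^\infty p_\beta(x^n)\pi(\beta)\,\mathrm d\beta\big/\int_0^\infty p_\beta(x^m)\pi(\beta)\,\mathrm d\beta$, and the posterior of $\beta$ given $x^m$ has density proportional to $p_\beta(x^m)\pi(\beta)$. *)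

theory Defs
  imports "HOL-Probability.Probability"
begin

definition gamma_density :: "real \<Rightarrow> real \<Rightarrow> real \<Rightarrow> real" where
  "gamma_density \<alpha> \<beta> x =
     (if 0 < x then \<beta> powr \<alpha> * x powr (\<alpha> - 1) / Gamma \<alpha> * exp (- \<beta> * x) else 0)"

definition gamma_distribution :: "real \<Rightarrow> real \<Rightarrow> real measure" where
  "gamma_distribution \<alpha> \<beta> = density lborel (\<lambda>x. ennreal (gamma_density \<alpha> \<beta> x))"

text \<open>A sequence \<open>x\<^sub>1 \<dots> x\<^sub>n\<close> is a function on \<open>nat\<close> of which only the values at
  \<open>1, \<dots>, n\<close> are used. Suprema, integrals of nonnegative functions and their quotients are
  taken in \<open>ennreal\<close>, so that none of them silently takes a default value when infinite.\<close>

definition seq_density :: "real \<Rightarrow> real \<Rightarrow> nat \<Rightarrow> (nat \<Rightarrow> real) \<Rightarrow> real" where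
  "seq_density \<alpha> \<beta> n x = (\<Prod>i = 1..n. gamma_density \<alpha> \<beta> (x i))"

definition seq_mean :: "nat \<Rightarrow> (nat \<Rightarrow> real) \<Rightarrow> real" where
  "seq_mean m x = (\<Sum>i = 1..m. x i) / real m"

definition max_likelihood :: "real \<Rightarrow> nat \<Rightarrow> (nat \<Rightarrow> real) \<Rightarrow> ennreal" where
  "max_likelihood \<alpha> n x = (SUP \<beta>\<in>{0<..}. ennreal (seq_density \<alpha> \<beta> n x))"

text \<open>\<open>merge {1..m} {m+1..n} (x, y)\<close> is the concatenation of \<open>x\<^sup>m\<close> with \<open>y\<close>, the latter
  indexed by \<open>m+1, \<dots>, n\<close>.\<close>

definition cnml_normalizer :: "real \<Rightarrow> nat \<Rightarrow> nat \<Rightarrow> (nat \<Rightarrow> real) \<Rightarrow> ennreal" where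
  "cnml_normalizer \<alpha> n m x =
     (\<integral>\<^sup>+ y \<in> (\<Pi>\<^sub>E i\<in>{m+1..n}. {0<..}).
        max_likelihood \<alpha> n (merge {1..m} {m+1..n} (x, y)) \<partial>(Pi\<^sub>M {m+1..n} (\<lambda>_. lborel)))"

definition cnml :: "real \<Rightarrow> nat \<Rightarrow> nat \<Rightarrow> (nat \<Rightarrow> real) \<Rightarrow> ennreal" where
  "cnml \<alpha> n m x = max_likelihood \<alpha> n x / cnml_normalizer \<alpha> n m x"

definition marginal :: "real \<Rightarrow> (real \<Rightarrow> real) \<Rightarrow> nat \<Rightarrow> (nat \<Rightarrow> real) \<Rightarrow> ennreal" where
  "marginal \<alpha> \<pi> n x = (\<integral>\<^sup>+ \<beta> \<in> {0<..}. ennreal (seq_density \<alpha> \<beta> n x * \<pi> \<beta>) \<partial>lborel)"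

definition bayes_predictor ::
    "real \<Rightarrow> (real \<Rightarrow> real) \<Rightarrow> nat \<Rightarrow> nat \<Rightarrow> (nat \<Rightarrow> real) \<Rightarrow> ennreal" where
  "bayes_predictor \<alpha> \<pi> n m x = marginal \<alpha> \<pi> n x / marginal \<alpha> \<pi> m x"

definition posterior :: "real \<Rightarrow> (real \<Rightarrow> real) \<Rightarrow> nat \<Rightarrow> (nat \<Rightarrow> real) \<Rightarrow> real measure" where
  "posterior \<alpha> \<pi> m x =
     density lborel (\<lambda>\<beta>. ennreal (seq_density \<alpha> \<beta> m x * \<pi> \<beta>) * indicator {0<..} \<beta>
                          / marginal \<alpha> \<pi> m x)"

text \<open>Jeffreys' prior is the square root of the Fisher information, here not normalized.\<close>

definition fisher_information :: "real \<Rightarrow> real \<Rightarrow> real" where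
  "fisher_information \<alpha> \<beta> =
     (LINT x | gamma_distribution \<alpha> \<beta>. (deriv (\<lambda>b. ln (gamma_density \<alpha> b x)) \<beta>)\<^sup>2)"

definition jeffreys_prior :: "real \<Rightarrow> real \<Rightarrow> real" where
  "jeffreys_prior \<alpha> \<beta> = sqrt (fisher_information \<alpha> \<beta>)"

text \<open>The distribution function of a Gamma distribution vanishes on \<open>(-\<infinity>, 0]\<close>, so its
  inverse is understood as that of its restriction to \<open>(0, \<infinity>)\<close>.\<close>

definition gamma_cdf_inv :: "real \<Rightarrow> real \<Rightarrow> real \<Rightarrow> real" where
  "gamma_cdf_inv \<alpha> \<beta> = inv_into {0<..} (cdf (gamma_distribution \<alpha> \<beta>))"

end

theory Submission
  imports Defs
begin

text \<open>
  Everything rests on one identity. For positive data \<open>x\<^sub>1 \<dots> x\<^sub>n\<close> with sum \<open>S\<close> the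
  likelihood times \<open>1/\<beta>\<close> is, as a function of \<open>\<beta>\<close>, a multiple \<open>evidence \<alpha> n x\<close> of the
  density of \<open>\<Gamma>(n\<alpha>, S)\<close> (\<open>seq_density_Jeffreys\<close>). Integrating over \<open>\<beta>\<close> shows that the
  evidence is the marginal likelihood under the prior \<open>1/\<beta>\<close>, and dividing by it gives the
  posterior. Jeffreys' prior is \<open>\<surd>\<alpha> / \<beta>\<close>, because the score is \<open>\<alpha>/\<beta> - x\<close>, whose second moment
  is the variance \<open>\<alpha>/\<beta>\<^sup>2\<close>; the constant cancels in every predictor and posterior.

  The likelihood is maximal at \<open>\<beta> = n\<alpha>/S\<close>, and there it equals the evidence up to a factor that
  depends on \<open>n\<alpha>\<close> only and not on the data (\<open>max_likelihood_eq\<close>). Hence integrating the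
  maximized likelihood over the continuations of \<open>x\<^sup>m\<close> amounts to integrating the marginal
  likelihood over them, which by Tonelli leaves the marginal likelihood of \<open>x\<^sup>m\<close>
  (\<open>cnml_normalizer_eq\<close>). The common factor cancels in the quotient, so CNML is Bayesian
  prediction.

  For the intervals, \<open>\<beta>\<close> is a scale parameter: \<open>\<Gamma>(s, b c)\<close> is \<open>\<Gamma>(s, b)\<close> divided by \<open>c\<close>
  (\<open>cdf_gamma_scale\<close>). Under the posterior, \<open>\<beta>\<close> times the mean of the data therefore has
  distribution \<open>\<Gamma>(m\<alpha>, m)\<close>. Under sampling at a fixed \<open>\<beta>\<close>, the sum of the data is
  \<open>\<Gamma>(m\<alpha>, \<beta>)\<close> (\<open>distributed_gamma_sum\<close>), so \<open>\<beta>\<close> times the mean again has distribution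
  \<open>\<Gamma>(m\<alpha>, m)\<close>. The same quantile thus serves both purposes.
\<close>

section \<open>Gamma densities\<close>

lemma Gamma_real_nonzero: "0 < a \<Longrightarrow> Gamma a \<noteq> 0" for a :: real
  using Gamma_real_pos[of a] by (metis less_irrefl)

lemma gamma_density_nonneg [simp]: "0 < a \<Longrightarrow> 0 \<le> gamma_density a b x"
  by (auto simp: gamma_density_def intro!: mult_nonneg_nonneg divide_nonneg_pos Gamma_real_pos)

lemma gamma_density_measurable [measurable]:
  "(\<lambda>z. gamma_density a (f z) (g z)) \<in> borel_measurable M"
  if [measurable]: "f \<in> borel_measurable M" "g \<in> borel_measurable M"
  unfolding gamma_density_def by measurable

lemma gamma_density_scale:
  assumes "0 < b" "0 < c"
  shows "c * gamma_density a b (c * x) = gamma_density a (b * c) x"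
proof (cases "0 < x")
  case True
  have "c powr (a - 1) = c powr a / c"
    using assms by (simp add: powr_diff)
  with True assms show ?thesis
    by (simp add: gamma_density_def powr_mult zero_less_mult_iff field_simps)
next
  case False
  then show ?thesis using assms by (auto simp: gamma_density_def zero_less_mult_iff)
qed

text \<open>The form in which the scaling of the rate is used: the factor \<open>c\<close> from the substitution
  \<open>x \<mapsto> c x\<close> is absorbed by the density.\<close>
lemma nn_integral_gamma_density_affine:
  assumes [measurable]: "f \<in> borel_measurable borel" and "0 < a" "0 < b" "0 < c"
  shows "(\<integral>\<^sup>+x. ennreal (gamma_density a b x) * f x \<partial>lborel) =
    (\<integral>\<^sup>+x. ennreal (gamma_density a (b * c) x) * f (c * x) \<partial>lborel)"
proof -
  have "(\<integral>\<^sup>+x. ennreal (gamma_density a b x) * f x \<partial>lborel) =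
      ennreal c * (\<integral>\<^sup>+x. ennreal (gamma_density a b (c * x)) * f (c * x) \<partial>lborel)"
    using assms by (subst nn_integral_real_affine[where c = c and t = 0]) simp_all
  also have "\<dots> = (\<integral>\<^sup>+x. ennreal c * (ennreal (gamma_density a b (c * x)) * f (c * x)) \<partial>lborel)"
    by (rule nn_integral_cmult[symmetric]) measurable
  also have "\<dots> = (\<integral>\<^sup>+x. ennreal (gamma_density a (b * c) x) * f (c * x) \<partial>lborel)"
    using assms
    by (intro nn_integral_cong)
       (simp add: gamma_density_scale[symmetric] ennreal_mult mult.assoc)
  finally show ?thesis .
qed

lemma nn_integral_gamma_density:
  assumes "0 < a" "0 < b"
  shows "(\<integral>\<^sup>+x. ennreal (gamma_density a b x) \<partial>lborel) = 1"
proof -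
  have "(\<integral>\<^sup>+x. ennreal (gamma_density a b x) \<partial>lborel) =
      (\<integral>\<^sup>+x. ennreal (gamma_density a 1 x) \<partial>lborel)"
    using nn_integral_gamma_density_affine[of "\<lambda>_. 1" a 1 b] assms by simp
  also have "\<dots> = (\<integral>\<^sup>+x. ennreal (1 / Gamma a) *
      (ennreal (x powr (a - 1) / exp x) * indicator {0..} x) \<partial>lborel)"
    using assms
    by (intro nn_integral_cong)
       (auto simp: gamma_density_def indicator_def exp_minus field_simps ennreal_mult[symmetric])
  also have "\<dots> = ennreal (1 / Gamma a) * ennreal (Gamma a)"
    using nn_integral_has_integral_lebesgue'[OF _ Gamma_integral_real[OF assms(1)]]
    by (subst nn_integral_cmult) auto
  also have "\<dots> = 1"
    using Gamma_real_pos[OF assms(1)] by (simp add: ennreal_mult[symmetric])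
  finally show ?thesis .
qed

lemma prob_space_gamma_distribution:
  "0 < a \<Longrightarrow> 0 < b \<Longrightarrow> prob_space (gamma_distribution a b)"
  by (intro prob_spaceI) (simp add: gamma_distribution_def emeasure_density nn_integral_gamma_density)

lemma sets_gamma_distribution [simp]: "sets (gamma_distribution a b) = sets borel"
  by (simp add: gamma_distribution_def)

lemma space_gamma_distribution [simp]: "space (gamma_distribution a b) = UNIV"
  by (simp add: gamma_distribution_def)

lemma has_bochner_integral_gamma_density:
  assumes "0 < a" "0 < b"
  shows "has_bochner_integral lborel (gamma_density a b) 1"
  using assms
  by (intro has_bochner_integral_nn_integral) (simp_all add: nn_integral_gamma_density)

section \<open>Fisher information and Jeffreys' prior\<close>

text \<open>Multiplying the density by \<open>x\<close> or \<open>x\<^sup>2\<close> raises the shape by 1 or 2, up to a constant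
  given by the recurrence of \<open>Gamma\<close>. So the integrand is a linear combination of three gamma
  densities, each with integral 1.\<close>
lemma has_bochner_integral_gamma_variance:
  assumes "0 < a" "0 < b"
  shows "has_bochner_integral lborel (\<lambda>x. gamma_density a b x * (a / b - x)\<^sup>2) (a / b\<^sup>2)"
proof -
  have G1: "Gamma (a + 1) = a * Gamma a"
    using assms by (intro Gamma_plus1) auto
  have G2: "Gamma (a + 2) = (a + 1) * (a * Gamma a)"
  proof -
    have "a + 1 \<notin> \<int>\<^sub>\<le>\<^sub>0"
      using assms by (auto dest: nonpos_Ints_nonpos)
    then show ?thesis using G1 Gamma_plus1[of "a + 1"] by (simp add: add.assoc)
  qed
  have eq: "gamma_density a b x * (a / b - x)\<^sup>2 =
      a * (a + 1) / b\<^sup>2 * gamma_density (a + 2) b x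
      + (- 2 * a\<^sup>2 / b\<^sup>2 * gamma_density (a + 1) b x + a\<^sup>2 / b\<^sup>2 * gamma_density a b x)" for x
  proof (cases "0 < x")
    case True
    let ?g = "gamma_density a b x"
    have p: "x powr (a + 1 - 1) = x powr (a - 1) * x" "x powr (a + 2 - 1) = x powr (a - 1) * x\<^sup>2"
      "b powr (a + 1) = b powr a * b" "b powr (a + 2) = b powr a * b\<^sup>2"
      using True assms powr_add[of x "a - 1" 1] powr_add[of x "a - 1" 2]
      by (simp_all add: powr_add algebra_simps)
    have nz: "Gamma a \<noteq> 0" "a \<noteq> 0" "a + 1 \<noteq> 0" "b \<noteq> 0"
      using assms Gamma_real_nonzero[OF assms(1)] by auto
    have g1: "gamma_density (a + 1) b x = b * x / a * ?g"
      using True nz unfolding gamma_density_def G1 p by simp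
    have g2: "gamma_density (a + 2) b x = b\<^sup>2 * x\<^sup>2 / (a * (a + 1)) * ?g"
      using True nz unfolding gamma_density_def G2 p by (simp add: mult_ac)
    have "a * (a + 1) / b\<^sup>2 * gamma_density (a + 2) b x = x\<^sup>2 * ?g"
      unfolding g2 using nz by simp
    moreover have "- 2 * a\<^sup>2 / b\<^sup>2 * gamma_density (a + 1) b x = - 2 * (a / b) * x * ?g"
      unfolding g1 using nz by (simp add: power2_eq_square)
    ultimately show ?thesis
      by (simp only: power2_diff power_divide) (simp add: algebra_simps)
  qed (simp add: gamma_density_def)
  have "has_bochner_integral lborel (\<lambda>x. gamma_density a b x * (a / b - x)\<^sup>2)
      (a * (a + 1) / b\<^sup>2 * 1 + (- 2 * a\<^sup>2 / b\<^sup>2 * 1 + a\<^sup>2 / b\<^sup>2 * 1))"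
    unfolding eq using assms
    by (intro has_bochner_integral_add has_bochner_integral_mult_right
        has_bochner_integral_gamma_density) auto
  also have "a * (a + 1) / b\<^sup>2 * 1 + (- 2 * a\<^sup>2 / b\<^sup>2 * 1 + a\<^sup>2 / b\<^sup>2 * 1) = a / b\<^sup>2"
    using assms by (simp add: field_simps power2_eq_square)
  finally show ?thesis .
qed

text \<open>At \<open>x \<le> 0\<close> the density vanishes for every rate, so its logarithm, whatever default value
  it has there, is constant in the rate.\<close>
lemma deriv_ln_gamma_density:
  assumes "0 < a" "0 < b"
  shows "deriv (\<lambda>b. ln (gamma_density a b x)) b = (if 0 < x then a / b - x else 0)"
proof (cases "0 < x")
  case True
  let ?g = "\<lambda>b. a * ln b + (ln (x powr (a - 1) / Gamma a) - b * x)"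
  have "eventually (\<lambda>b. b \<in> {0<..}) (nhds b)"
    using assms by (intro eventually_nhds_in_open) auto
  then have ev: "eventually (\<lambda>b. ln (gamma_density a b x) = ?g b) (nhds b)"
  proof eventually_elim
    case (elim b)
    have "gamma_density a b x = b powr a * (x powr (a - 1) / Gamma a * exp (- b * x))"
      using True by (simp add: gamma_density_def)
    also have "ln \<dots> = ?g b"
      using True elim Gamma_real_pos[OF assms(1)]
      by (subst ln_mult_pos, simp, simp, subst ln_mult_pos) (simp_all add: ln_powr)
    finally show ?case .
  qed
  have "deriv (\<lambda>b. ln (gamma_density a b x)) b = deriv ?g b"
    using ev by (rule deriv_cong_ev) simp
  also have "\<dots> = a / b - x"
    using assms by (intro DERIV_imp_deriv) (auto intro!: derivative_eq_intros simp: field_simps)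
  finally show ?thesis using True by simp
qed (simp add: gamma_density_def)

lemma jeffreys_prior_gamma:
  assumes "0 < a" "0 < b"
  shows "jeffreys_prior a b = sqrt a * (1 / b)"
proof -
  have "fisher_information a b =
      (LINT x|lborel. gamma_density a b x * (if 0 < x then a / b - x else 0)\<^sup>2)"
    unfolding fisher_information_def gamma_distribution_def
      deriv_ln_gamma_density[OF assms]
    using assms by (subst integral_real_density) auto
  also have "\<dots> = (LINT x|lborel. gamma_density a b x * (a / b - x)\<^sup>2)"
    by (intro Bochner_Integration.integral_cong) (auto simp: gamma_density_def)
  also have "\<dots> = a / b\<^sup>2"
    using has_bochner_integral_gamma_variance[OF assms] by (rule has_bochner_integral_integral_eq)
  finally show ?thesis
    using assms by (simp add: jeffreys_prior_def real_sqrt_divide)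
qed

section \<open>Sums of independent gamma variables\<close>

text \<open>The exponentials combine to \<open>exp (- \<beta> z)\<close>, which no longer depends on \<open>y\<close>, and the
  substitution \<open>y = z t\<close> turns the remaining integral into a Beta integral, whose value
  \<open>Gamma a * Gamma b / Gamma (a + b)\<close> corrects the normalization.\<close>
lemma nn_integral_gamma_convolution:
  assumes "0 < a" "0 < b" "0 < \<beta>"
  shows "(\<integral>\<^sup>+y. ennreal (gamma_density a \<beta> (z - y)) * ennreal (gamma_density b \<beta> y) \<partial>lborel) =
    ennreal (gamma_density (a + b) \<beta> z)"
proof (cases "0 < z")
  case True
  define C where "C = \<beta> powr (a + b) * z powr (a + b - 1) * exp (- \<beta> * z) / (Gamma a * Gamma b)"
  have G: "0 < Gamma a" "0 < Gamma b" "0 < Gamma (a + b)"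
    using assms by (auto intro!: Gamma_real_pos)
  have C: "0 \<le> C" using G by (simp add: C_def)
  have eq: "z * (gamma_density a \<beta> (z - z * t) * gamma_density b \<beta> (z * t)) =
      C * (t powr (b - 1) * (1 - t) powr (a - 1) * indicator {0..1} t)" for t
  proof (cases "0 < t \<and> t < 1")
    case t: True
    have 1: "z - z * t = z * (1 - t)" by (simp add: algebra_simps)
    have pos: "0 < z * (1 - t)" "0 < z * t" using t True by auto
    have e: "exp (- \<beta> * (z * (1 - t))) * exp (- \<beta> * (z * t)) = exp (- \<beta> * z)"
      unfolding exp_add[symmetric] by (simp add: algebra_simps)
    have p: "(z * (1 - t)) powr (a - 1) = z powr (a - 1) * (1 - t) powr (a - 1)"
      "(z * t) powr (b - 1) = z powr (b - 1) * t powr (b - 1)"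
      "\<beta> powr (a + b) = \<beta> powr a * \<beta> powr b"
      using t True by (simp_all add: powr_mult powr_add)
    have "z powr (a + b - 1) = z powr ((a - 1) + (b - 1) + 1)" by simp
    also have "\<dots> = z powr (a - 1) * z powr (b - 1) * z"
      using True by (subst powr_add, subst powr_add) simp
    finally have q: "z powr (a + b - 1) = z powr (a - 1) * z powr (b - 1) * z" .
    show ?thesis
      using t pos unfolding 1 C_def e[symmetric] gamma_density_def p q
      by (simp add: algebra_simps)
  next
    case False
    then have "t \<le> 0 \<or> 1 \<le> t" by auto
    then have "z * t \<le> 0 \<or> z - z * t \<le> 0"
      using True by (auto simp: mult_le_0_iff)
    then have "gamma_density a \<beta> (z - z * t) * gamma_density b \<beta> (z * t) = 0"
      by (auto simp: gamma_density_def)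
    moreover have "t powr (b - 1) * (1 - t) powr (a - 1) * indicator {0..1} t = (0::real)"
      using False by (auto simp: indicator_def)
    ultimately show ?thesis by (simp only: mult_zero_right)
  qed
  have "(\<integral>\<^sup>+y. ennreal (gamma_density a \<beta> (z - y)) * ennreal (gamma_density b \<beta> y) \<partial>lborel) =
      ennreal z * (\<integral>\<^sup>+t. ennreal (gamma_density a \<beta> (z - z * t)) *
        ennreal (gamma_density b \<beta> (z * t)) \<partial>lborel)"
    using True by (subst nn_integral_real_affine[where c = z and t = 0]) simp_all
  also have "\<dots> = (\<integral>\<^sup>+t. ennreal z * (ennreal (gamma_density a \<beta> (z - z * t)) *
        ennreal (gamma_density b \<beta> (z * t))) \<partial>lborel)"
    by (rule nn_integral_cmult[symmetric]) measurable
  also have "\<dots> = (\<integral>\<^sup>+t. ennreal C *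
      (ennreal (t powr (b - 1) * (1 - t) powr (a - 1)) * indicator {0..1} t) \<partial>lborel)"
  proof (intro nn_integral_cong)
    fix t
    have "ennreal z * (ennreal (gamma_density a \<beta> (z - z * t)) * ennreal (gamma_density b \<beta> (z * t)))
        = ennreal (z * (gamma_density a \<beta> (z - z * t) * gamma_density b \<beta> (z * t)))"
      using True assms by (simp add: ennreal_mult)
    also have "\<dots> = ennreal C * (ennreal (t powr (b - 1) * (1 - t) powr (a - 1)) * indicator {0..1} t)"
      unfolding eq using C by (auto simp: indicator_def ennreal_mult)
    finally show "ennreal z * (ennreal (gamma_density a \<beta> (z - z * t)) *
        ennreal (gamma_density b \<beta> (z * t))) =
      ennreal C * (ennreal (t powr (b - 1) * (1 - t) powr (a - 1)) * indicator {0..1} t)" .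
  qed
  also have "\<dots> = ennreal C * ennreal (Beta b a)"
    using nn_integral_has_integral_lebesgue'[OF _ has_integral_Beta_real[of b a]] assms
    by (subst nn_integral_cmult) auto
  also have "\<dots> = ennreal (gamma_density (a + b) \<beta> z)"
    using True G C by (simp add: ennreal_mult'[symmetric] C_def Beta_def gamma_density_def field_simps)
  finally show ?thesis .
next
  case False
  then have "gamma_density a \<beta> (z - y) = 0 \<or> gamma_density b \<beta> y = 0" for y
    by (auto simp: gamma_density_def)
  then have "ennreal (gamma_density a \<beta> (z - y)) * ennreal (gamma_density b \<beta> y) = 0" for y
    by (metis ennreal_0 mult_zero_left mult_zero_right)
  then have "(\<integral>\<^sup>+y. ennreal (gamma_density a \<beta> (z - y)) * ennreal (gamma_density b \<beta> y) \<partial>lborel) = 0"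
    by (simp only: nn_integral_const) simp
  with False show ?thesis by (simp add: gamma_density_def)
qed

lemma (in prob_space) distributed_gamma_sum:
  assumes "finite I" "I \<noteq> {}" "0 < \<beta>" "\<And>i. i \<in> I \<Longrightarrow> 0 < a i"
    and "indep_vars (\<lambda>_. borel) X I"
    and "\<And>i. i \<in> I \<Longrightarrow> distributed M lborel (X i) (\<lambda>t. ennreal (gamma_density (a i) \<beta> t))"
  shows "distributed M lborel (\<lambda>\<omega>. \<Sum>i\<in>I. X i \<omega>)
    (\<lambda>t. ennreal (gamma_density (\<Sum>i\<in>I. a i) \<beta> t))"
  using assms
proof (induct rule: finite_ne_induct)
  case (singleton i)
  then show ?case by simp
next
  case (insert i I)
  have "distributed M lborel (\<lambda>\<omega>. X i \<omega> + (\<Sum>i\<in>I. X i \<omega>))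
      (\<lambda>z. \<integral>\<^sup>+y. ennreal (gamma_density (a i) \<beta> (z - y)) *
        ennreal (gamma_density (\<Sum>i\<in>I. a i) \<beta> y) \<partial>lborel)"
    using insert
    by (intro distributed_convolution indep_vars_sum) (auto intro!: insert(4) intro: indep_vars_subset)
  moreover have "0 < (\<Sum>i\<in>I. a i)" using insert by (intro sum_pos) auto
  ultimately show ?case
    using insert by (simp add: nn_integral_gamma_convolution)
qed

section \<open>Likelihood, marginal likelihood and posterior\<close>

lemma seq_density_eq:
  assumes "0 < \<beta>" "\<forall>i\<in>{1..n}. 0 < x i"
  shows "seq_density a \<beta> n x =
    (\<Prod>i=1..n. x i powr (a - 1) / Gamma a) *
    (\<beta> powr (real n * a) * exp (- \<beta> * (\<Sum>i=1..n. x i)))"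
proof -
  have "seq_density a \<beta> n x =
      (\<Prod>i=1..n. (x i powr (a - 1) / Gamma a) * (\<beta> powr a * exp (- \<beta> * x i)))"
    unfolding seq_density_def using assms by (intro prod.cong) (auto simp: gamma_density_def)
  also have "\<dots> = (\<Prod>i=1..n. x i powr (a - 1) / Gamma a) *
      ((\<beta> powr a) ^ n * (\<Prod>i=1..n. exp (- \<beta> * x i)))"
    by (simp only: prod.distrib) simp
  also have "(\<beta> powr a) ^ n = \<beta> powr (real n * a)"
    using assms by (simp add: powr_power mult.commute)
  also have "(\<Prod>i=1..n. exp (- \<beta> * x i)) = exp (- \<beta> * (\<Sum>i=1..n. x i))"
    by (simp add: exp_sum[symmetric] sum_distrib_left)
  finally show ?thesis .
qed

text \<open>The marginal likelihood of \<open>x\<^sup>n\<close> under the prior \<open>1/\<beta>\<close>, in closed form.\<close>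
definition evidence :: "real \<Rightarrow> nat \<Rightarrow> (nat \<Rightarrow> real) \<Rightarrow> real" where
  "evidence a n x = (\<Prod>i=1..n. x i powr (a - 1) / Gamma a) * Gamma (real n * a) /
     (\<Sum>i=1..n. x i) powr (real n * a)"

lemma sum_pos_data:
  "1 \<le> n \<Longrightarrow> \<forall>i\<in>{1..n}. 0 < x i \<Longrightarrow> 0 < (\<Sum>i=1..n. x i)" for x :: "nat \<Rightarrow> real"
  by (intro sum_pos) auto

lemma evidence_pos:
  assumes "0 < a" "1 \<le> n" "\<forall>i\<in>{1..n}. 0 < x i"
  shows "0 < evidence a n x"
proof -
  have "0 < Gamma a" "0 < Gamma (real n * a)"
    using assms by (auto intro!: Gamma_real_pos)
  then show ?thesis
    using assms sum_pos_data[OF assms(2,3)]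
    unfolding evidence_def by (intro divide_pos_pos mult_pos_pos prod_pos) (force simp del: One_nat_def)+
qed

text \<open>The factor \<open>1/\<beta>\<close> lowers the exponent of \<open>\<beta>\<close> from \<open>n\<alpha>\<close> to \<open>n\<alpha> - 1\<close>, exactly as in a
  gamma density of shape \<open>n\<alpha>\<close>. This is why the prior \<open>1/\<beta>\<close>, and not another power of \<open>\<beta>\<close>,
  makes the evidence proportional to the maximized likelihood by a constant free of the data:
  both are then homogeneous in \<open>S\<close> of degree \<open>- n\<alpha>\<close>.\<close>
lemma seq_density_Jeffreys:
  assumes "0 < a" "1 \<le> n" "\<forall>i\<in>{1..n}. 0 < x i" "0 < \<beta>"
  shows "seq_density a \<beta> n x * (1 / \<beta>) =
    evidence a n x * gamma_density (real n * a) (\<Sum>i=1..n. x i) \<beta>"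
proof -
  have "Gamma (real n * a) \<noteq> 0"
    using assms by (intro Gamma_real_nonzero) simp
  then show ?thesis
    using assms sum_pos_data[OF assms(2,3)]
    by (simp add: seq_density_eq[OF assms(4,3)] evidence_def gamma_density_def powr_diff)
qed

section \<open>Maximized likelihood and CNML\<close>

text \<open>The ratio of the maximized likelihood to the evidence, with \<open>s = n\<alpha>\<close>.\<close>

definition cnml_factor :: "real \<Rightarrow> real" where
  "cnml_factor s = s powr s * exp (- s) / Gamma s"

lemma cnml_factor_pos: "0 < s \<Longrightarrow> 0 < cnml_factor s"
  by (simp add: cnml_factor_def Gamma_real_pos)

text \<open>This is \<open>ln t \<le> t - 1\<close> at \<open>t = \<beta> S / s\<close>, multiplied by \<open>s\<close> and exponentiated. Equality
  holds at the maximum likelihood estimate \<open>\<beta> = s / S\<close>.\<close>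
lemma powr_mult_exp_le:
  fixes \<beta> s S :: real
  assumes "0 < \<beta>" "0 < s" "0 < S"
  shows "\<beta> powr s * exp (- (\<beta> * S)) \<le> (s / S) powr s * exp (- s)"
proof -
  have "ln (\<beta> * S / s) \<le> \<beta> * S / s - 1"
    using assms by (intro ln_le_minus_one) simp
  then have "s * ln (\<beta> * S / s) \<le> s * (\<beta> * S / s - 1)"
    using assms by (intro mult_left_mono) auto
  also have "\<dots> = \<beta> * S - s" using assms by (simp add: field_simps)
  finally have "s * ln \<beta> - \<beta> * S \<le> s * ln (s / S) - s"
    using assms by (simp add: ln_mult ln_div algebra_simps)
  then have "exp (s * ln \<beta> - \<beta> * S) \<le> exp (s * ln (s / S) - s)" by simp
  then show ?thesis
    using assms by (simp add: powr_def exp_diff exp_minus field_simps)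
qed

lemma max_likelihood_eq:
  assumes "0 < a" "1 \<le> n" "\<forall>i\<in>{1..n}. 0 < x i"
  shows "max_likelihood a n x = ennreal (cnml_factor (real n * a) * evidence a n x)"
proof -
  define s where "s = real n * a"
  define S where "S = (\<Sum>i=1..n. x i)"
  define P where "P = (\<Prod>i=1..n. x i powr (a - 1) / Gamma a)"
  have s: "0 < s" using assms by (simp add: s_def)
  have S: "0 < S" using sum_pos_data[OF assms(2,3)] by (simp add: S_def)
  have P: "0 \<le> P" unfolding P_def
    using assms Gamma_real_pos[OF assms(1)] by (intro prod_nonneg) auto
  have L: "seq_density a \<beta> n x = P * (\<beta> powr s * exp (- \<beta> * S))" if "0 < \<beta>" for \<beta>
    using seq_density_eq[OF that assms(3)] by (simp add: P_def s_def S_def)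
  have "max_likelihood a n x = ennreal (P * ((s / S) powr s * exp (- s)))"
    unfolding max_likelihood_def
  proof (rule antisym)
    show "(SUP \<beta>\<in>{0<..}. ennreal (seq_density a \<beta> n x)) \<le> ennreal (P * ((s / S) powr s * exp (- s)))"
      using P s S by (intro SUP_least ennreal_leI) (auto simp: L intro!: mult_left_mono powr_mult_exp_le)
    have "seq_density a (s / S) n x = P * ((s / S) powr s * exp (- s))"
      using s S by (simp add: L)
    then show "ennreal (P * ((s / S) powr s * exp (- s))) \<le> (SUP \<beta>\<in>{0<..}. ennreal (seq_density a \<beta> n x))"
      using s S by (intro SUP_upper2[of "s / S"]) auto
  qed
  also have "P * ((s / S) powr s * exp (- s)) = cnml_factor s * evidence a n x"
  proof -
    have "Gamma s \<noteq> 0" using s by (rule Gamma_real_nonzero)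
    then show ?thesis
      unfolding cnml_factor_def evidence_def P_def[symmetric] s_def[symmetric] S_def[symmetric]
      using s S by (simp add: powr_divide)
  qed
  finally show ?thesis by (simp add: s_def)
qed

lemma marginal_eq:
  assumes "0 < a" "1 \<le> n" "\<forall>i\<in>{1..n}. 0 < x i" "0 < c" "\<forall>\<beta>>0. \<pi> \<beta> = c * (1 / \<beta>)"
  shows "marginal a \<pi> n x = ennreal (c * evidence a n x)"
proof -
  have s: "0 < real n * a" using assms by simp
  have E: "0 < c * evidence a n x" using evidence_pos[OF assms(1-3)] assms(4) by simp
  have "marginal a \<pi> n x = (\<integral>\<^sup>+\<beta>. ennreal (c * evidence a n x) *
      ennreal (gamma_density (real n * a) (\<Sum>i=1..n. x i) \<beta>) \<partial>lborel)"
    unfolding marginal_def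
  proof (intro nn_integral_cong)
    fix \<beta> :: real
    show "ennreal (seq_density a \<beta> n x * \<pi> \<beta>) * indicator {0<..} \<beta> = ennreal (c * evidence a n x) *
      ennreal (gamma_density (real n * a) (\<Sum>i=1..n. x i) \<beta>)"
    proof (cases "0 < \<beta>")
      case True
      have "seq_density a \<beta> n x * \<pi> \<beta> = c * (seq_density a \<beta> n x * (1 / \<beta>))"
        using True assms by simp
      also have "\<dots> = c * evidence a n x * gamma_density (real n * a) (\<Sum>i=1..n. x i) \<beta>"
        using seq_density_Jeffreys[OF assms(1-3) True] by simp
      finally show ?thesis using True s E by (simp add: ennreal_mult)
    qed (simp add: gamma_density_def)
  qed
  also have "\<dots> = ennreal (c * evidence a n x)"
    using s sum_pos_data[OF assms(2,3)]
    by (subst nn_integral_cmult) (auto simp: nn_integral_gamma_density)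
  finally show ?thesis .
qed

lemma posterior_eq:
  assumes "0 < a" "1 \<le> n" "\<forall>i\<in>{1..n}. 0 < x i" "0 < c" "\<forall>\<beta>>0. \<pi> \<beta> = c * (1 / \<beta>)"
  shows "posterior a \<pi> n x = gamma_distribution (real n * a) (real n * seq_mean n x)"
proof -
  have S: "real n * seq_mean n x = (\<Sum>i=1..n. x i)"
    using assms by (simp add: seq_mean_def)
  have E: "0 < c * evidence a n x" using evidence_pos[OF assms(1-3)] assms(4) by simp
  have "ennreal (seq_density a \<beta> n x * \<pi> \<beta>) * indicator {0<..} \<beta> / marginal a \<pi> n x =
      ennreal (gamma_density (real n * a) (\<Sum>i=1..n. x i) \<beta>)" for \<beta>
  proof (cases "0 < \<beta>")
    case True
    have g: "0 \<le> gamma_density (real n * a) (\<Sum>i=1..n. x i) \<beta>"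
      using assms by simp
    have "seq_density a \<beta> n x * \<pi> \<beta> = c * (seq_density a \<beta> n x * (1 / \<beta>))"
      using True assms by simp
    also have "\<dots> = c * evidence a n x * gamma_density (real n * a) (\<Sum>i=1..n. x i) \<beta>"
      using seq_density_Jeffreys[OF assms(1-3) True] by simp
    finally have "seq_density a \<beta> n x * \<pi> \<beta> =
      c * evidence a n x * gamma_density (real n * a) (\<Sum>i=1..n. x i) \<beta>" .
    then show ?thesis
      using True E g evidence_pos[OF assms(1-3)] assms(4)
      by (simp add: marginal_eq[OF assms] divide_ennreal)
  qed (simp add: gamma_density_def)
  then show ?thesis
    by (simp add: posterior_def gamma_distribution_def S)
qed

lemma seq_density_merge:
  assumes "m < n"
  shows "seq_density a \<beta> n (merge {1..m} {m+1..n} (x, y)) =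
    seq_density a \<beta> m x * (\<Prod>i\<in>{m+1..n}. gamma_density a \<beta> (y i))"
proof -
  have "{1..n} = {1..m} \<union> {m+1..n}" using assms by auto
  then have "seq_density a \<beta> n (merge {1..m} {m+1..n} (x, y)) =
      (\<Prod>i\<in>{1..m}. gamma_density a \<beta> (merge {1..m} {m+1..n} (x, y) i)) *
      (\<Prod>i\<in>{m+1..n}. gamma_density a \<beta> (merge {1..m} {m+1..n} (x, y) i))"
    unfolding seq_density_def by (simp only:) (intro prod.union_disjoint, auto)
  also have "(\<Prod>i\<in>{1..m}. gamma_density a \<beta> (merge {1..m} {m+1..n} (x, y) i)) = seq_density a \<beta> m x"
    unfolding seq_density_def by (intro prod.cong) (auto simp: merge_def)
  also have "(\<Prod>i\<in>{m+1..n}. gamma_density a \<beta> (merge {1..m} {m+1..n} (x, y) i)) =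
      (\<Prod>i\<in>{m+1..n}. gamma_density a \<beta> (y i))"
    by (intro prod.cong) (auto simp: merge_def)
  finally show ?thesis .
qed

text \<open>Since the maximized likelihood is a constant times the marginal likelihood, Tonelli's theorem
  lets the continuation be integrated out first, at fixed \<open>\<beta>\<close>; there each new observation
  contributes the total mass 1 of its density. The normalizer is thus finite.\<close>
lemma cnml_normalizer_eq:
  assumes "0 < a" "1 \<le> m" "m < n" "\<forall>i\<in>{1..m}. 0 < x i"
  shows "cnml_normalizer a n m x = ennreal (cnml_factor (real n * a) * evidence a m x)"
proof -
  let ?J = "{m+1..n}" and ?K = "ennreal (cnml_factor (real n * a))"
  let ?P = "\<Pi>\<^sub>M i\<in>?J. (lborel :: real measure)"
  let ?g = "\<lambda>\<beta> y. \<Prod>i\<in>?J. ennreal (gamma_density a \<beta> (y i))"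
  let ?h = "\<lambda>\<beta>. ennreal (seq_density a \<beta> m x * (1 / \<beta>)) * indicator {0<..} \<beta>"
  interpret P: product_sigma_finite "\<lambda>_::nat. lborel :: real measure" ..
  interpret PJ: sigma_finite_measure ?P by (rule P.sigma_finite) simp
  interpret pair_sigma_finite ?P "lborel :: real measure" ..
  have K: "0 < cnml_factor (real n * a)"
    using assms by (intro cnml_factor_pos) simp
  have [measurable]: "(\<lambda>\<beta>. seq_density a \<beta> m x) \<in> borel_measurable borel"
    unfolding seq_density_def by measurable
  have eq: "max_likelihood a n (merge {1..m} ?J (x, y)) * indicator (\<Pi>\<^sub>E i\<in>?J. {0<..}) y =
      ?K * (\<integral>\<^sup>+\<beta>. ?h \<beta> * ?g \<beta> y \<partial>lborel)" if y: "y \<in> space ?P" for y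
  proof (cases "y \<in> (\<Pi>\<^sub>E i\<in>?J. {0<..})")
    case True
    let ?z = "merge {1..m} ?J (x, y)"
    have z: "\<forall>i\<in>{1..n}. 0 < ?z i"
      using True assms by (auto simp: merge_def PiE_iff)
    have n: "1 \<le> n" using assms by simp
    have marg: "marginal a (\<lambda>\<beta>. 1 / \<beta>) n ?z = ennreal (evidence a n ?z)"
      by (subst marginal_eq[OF assms(1) n z, where c = 1]) auto
    have "max_likelihood a n ?z = ?K * marginal a (\<lambda>\<beta>. 1 / \<beta>) n ?z"
      unfolding max_likelihood_eq[OF assms(1) n z] marg
      by (intro ennreal_mult less_imp_le K evidence_pos[OF assms(1) n z])
    also have "marginal a (\<lambda>\<beta>. 1 / \<beta>) n ?z = (\<integral>\<^sup>+\<beta>. ?h \<beta> * ?g \<beta> y \<partial>lborel)"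
      unfolding marginal_def seq_density_merge[OF assms(3)]
    proof (intro nn_integral_cong)
      fix \<beta> :: real
      have "?h \<beta> * ?g \<beta> y = ennreal (seq_density a \<beta> m x * (1 / \<beta>)) *
          ennreal (\<Prod>i\<in>?J. gamma_density a \<beta> (y i)) * indicator {0<..} \<beta>"
        using assms(1) by (simp only: prod_ennreal gamma_density_nonneg mult_ac)
      also have "\<dots> = ennreal (seq_density a \<beta> m x * (1 / \<beta>) *
          (\<Prod>i\<in>?J. gamma_density a \<beta> (y i))) * indicator {0<..} \<beta>"
        using assms(1) by (subst ennreal_mult'') (auto intro!: prod_nonneg)
      finally show "ennreal (seq_density a \<beta> m x * (\<Prod>i\<in>?J. gamma_density a \<beta> (y i)) * (1 / \<beta>)) *
         indicator {0<..} \<beta> = ?h \<beta> * ?g \<beta> y"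
        by (simp only: mult_ac)
    qed
    finally show ?thesis using True by simp
  next
    case False
    \<comment> \<open>Off the positive orthant some coordinate has density zero, so the mixture vanishes too.\<close>
    then obtain i where i: "i \<in> ?J" "\<not> 0 < y i"
      using y by (auto simp: space_PiM PiE_iff)
    then have "?g \<beta> y = 0" for \<beta>
      by (intro prod_zero) (auto simp: gamma_density_def)
    then have "(\<integral>\<^sup>+\<beta>. ?h \<beta> * ?g \<beta> y \<partial>lborel) = 0"
      by (simp only: mult_zero_right nn_integral_const mult_zero_left)
    then show ?thesis by (simp only: indicator_simps(2)[OF False] mult_zero_right)
  qed
  have "cnml_normalizer a n m x = (\<integral>\<^sup>+y. ?K * (\<integral>\<^sup>+\<beta>. ?h \<beta> * ?g \<beta> y \<partial>lborel) \<partial>?P)"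
    unfolding cnml_normalizer_def by (intro nn_integral_cong eq)
  also have "\<dots> = ?K * (\<integral>\<^sup>+y. (\<integral>\<^sup>+\<beta>. ?h \<beta> * ?g \<beta> y \<partial>lborel) \<partial>?P)"
    by (intro nn_integral_cmult) measurable
  also have "(\<integral>\<^sup>+y. (\<integral>\<^sup>+\<beta>. ?h \<beta> * ?g \<beta> y \<partial>lborel) \<partial>?P) =
      (\<integral>\<^sup>+\<beta>. (\<integral>\<^sup>+y. ?h \<beta> * ?g \<beta> y \<partial>?P) \<partial>lborel)"
    by (intro Fubini'[symmetric]) measurable
  also have "\<dots> = (\<integral>\<^sup>+\<beta>. ?h \<beta> \<partial>lborel)"
  proof (intro nn_integral_cong)
    fix \<beta> :: real
    show "(\<integral>\<^sup>+y. ?h \<beta> * ?g \<beta> y \<partial>?P) = ?h \<beta>"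
    proof (cases "0 < \<beta>")
      case True
      have "(\<integral>\<^sup>+y. ?h \<beta> * ?g \<beta> y \<partial>?P) = ?h \<beta> * (\<integral>\<^sup>+y. ?g \<beta> y \<partial>?P)"
        by (intro nn_integral_cmult) measurable
      also have "(\<integral>\<^sup>+y. ?g \<beta> y \<partial>?P) = (\<Prod>i\<in>?J. \<integral>\<^sup>+t. ennreal (gamma_density a \<beta> t) \<partial>lborel)"
        by (intro P.product_nn_integral_prod) auto
      also have "\<dots> = 1"
        using True assms by (simp add: nn_integral_gamma_density)
      finally show ?thesis by simp
    qed simp
  qed
  also have "\<dots> = marginal a (\<lambda>\<beta>. 1 / \<beta>) m x"
    by (simp add: marginal_def)
  also have "\<dots> = ennreal (evidence a m x)"
    by (subst marginal_eq[OF assms(1,2,4), where c = 1]) auto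
  finally show ?thesis
    using K evidence_pos[OF assms(1,2,4)] by (simp add: ennreal_mult)
qed

lemma cnml_eq_bayes:
  assumes "0 < a" "1 \<le> m" "m < n" "\<forall>i\<in>{1..n}. 0 < x i" "0 < c" "\<forall>\<beta>>0. \<pi> \<beta> = c * (1 / \<beta>)"
  shows "cnml a n m x = bayes_predictor a \<pi> n m x"
proof -
  have n: "1 \<le> n" and xm: "\<forall>i\<in>{1..m}. 0 < x i" using assms by auto
  have "0 < cnml_factor (real n * a)"
    using assms by (intro cnml_factor_pos) simp
  moreover note evidence_pos[OF assms(1) n assms(4)] evidence_pos[OF assms(1,2) xm]
  ultimately show ?thesis
    using assms(5)
    by (simp add: cnml_def bayes_predictor_def max_likelihood_eq[OF assms(1) n assms(4)]
        cnml_normalizer_eq[OF assms(1-3) xm] marginal_eq[OF assms(1) n assms(4-6)]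
        marginal_eq[OF assms(1,2) xm assms(5,6)] divide_ennreal)
qed

section \<open>Distribution function and quantiles\<close>

lemma cdf_gamma_scale:
  assumes "0 < a" "0 < b" "0 < c"
  shows "cdf (gamma_distribution a (b * c)) t = cdf (gamma_distribution a b) (c * t)"
proof -
  have "emeasure (gamma_distribution a b) {..c * t} =
      (\<integral>\<^sup>+x. ennreal (gamma_density a b x) * indicator {..c * t} x \<partial>lborel)"
    by (simp add: gamma_distribution_def emeasure_density)
  also have "\<dots> = (\<integral>\<^sup>+x. ennreal (gamma_density a (b * c) x) * indicator {..c * t} (c * x) \<partial>lborel)"
    using assms by (intro nn_integral_gamma_density_affine) auto
  also have "\<dots> = (\<integral>\<^sup>+x. ennreal (gamma_density a (b * c) x) * indicator {..t} x \<partial>lborel)"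
    using assms by (intro nn_integral_cong) (auto simp: indicator_def)
  also have "\<dots> = emeasure (gamma_distribution a (b * c)) {..t}"
    by (simp add: gamma_distribution_def emeasure_density)
  finally show ?thesis by (simp add: cdf_def measure_def)
qed

lemma measure_gamma_singleton: "measure (gamma_distribution a b) {t} = 0"
proof -
  have "emeasure (gamma_distribution a b) {t} = 0"
    unfolding gamma_distribution_def by (subst emeasure_density) (auto intro!: nn_integral_null_set)
  then show ?thesis by (simp add: measure_def)
qed

lemma measure_gamma_nonpos: "measure (gamma_distribution a b) {..0} = 0"
proof -
  have "emeasure (gamma_distribution a b) {..0} =
     (\<integral>\<^sup>+x. ennreal (gamma_density a b x) * indicator {..0} x \<partial>lborel)"
    by (simp add: gamma_distribution_def emeasure_density)
  also have "\<dots> = (\<integral>\<^sup>+x. 0 \<partial>(lborel :: real measure))"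
    by (intro nn_integral_cong) (auto simp: gamma_density_def indicator_def)
  finally show ?thesis by (simp add: measure_def)
qed

lemma measure_gamma_Icc:
  assumes "0 < a" "0 < b" "0 \<le> t"
  shows "measure (gamma_distribution a b) {0..t} = cdf (gamma_distribution a b) t"
proof -
  interpret prob_space "gamma_distribution a b" by (rule prob_space_gamma_distribution[OF assms(1,2)])
  have "{..t} = {..<0} \<union> {0..t}" using assms by auto
  then have "cdf (gamma_distribution a b) t =
     measure (gamma_distribution a b) {..<0} + measure (gamma_distribution a b) {0..t}"
    unfolding cdf_def by (simp only:) (intro finite_measure_Union, auto)
  moreover have "measure (gamma_distribution a b) {..<0} \<le> measure (gamma_distribution a b) {..0}"
    by (intro finite_measure_mono) auto
  ultimately show ?thesis
    using measure_gamma_nonpos[of a b] measure_nonneg[of "gamma_distribution a b" "{..<0}"] by simp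
qed

text \<open>The distribution function is strictly increasing on \<open>[0, \<infinity>)\<close> because the density is positive
  on \<open>(0, \<infinity>)\<close>, and continuous because there are no atoms; surjectivity is the intermediate value
  theorem between the value 0 at 0 and the limit 1 at infinity.\<close>
lemma bij_betw_gamma_cdf:
  assumes "0 < a" "0 < b"
  shows "bij_betw (cdf (gamma_distribution a b)) {0<..} {0<..<1}"
proof -
  let ?G = "gamma_distribution a b" and ?F = "cdf (gamma_distribution a b)"
  interpret prob_space ?G by (rule prob_space_gamma_distribution[OF assms])
  interpret real_distribution ?G by standard simp_all
  have strict: "?F s < ?F t" if "0 \<le> s" "s < t" for s t
  proof -
    have "emeasure ?G {s<..t} \<noteq> 0"
    proof
      assume "emeasure ?G {s<..t} = 0"
      then have "(\<integral>\<^sup>+x. ennreal (gamma_density a b x) * indicator {s<..t} x \<partial>lborel) = 0"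
        by (simp add: gamma_distribution_def emeasure_density)
      then have "AE x in lborel. ennreal (gamma_density a b x) * indicator {s<..t} x = 0"
        by (subst (asm) nn_integral_0_iff_AE) auto
      then have "AE x in lborel. x \<notin> {s<..t}"
      proof eventually_elim
        case (elim x)
        have "x \<in> {s<..t} \<Longrightarrow> 0 < gamma_density a b x"
          using that assms Gamma_real_pos[OF assms(1)] by (simp add: gamma_density_def)
        with elim show ?case by (auto simp: indicator_def ennreal_eq_0_iff split: if_splits)
      qed
      then have "emeasure lborel {s<..t} = 0"
        by (subst (asm) AE_iff_measurable[of "{s<..t}"]) auto
      then show False using that by simp
    qed
    then have "0 < measure ?G {s<..t}"
      by (simp add: emeasure_eq_measure zero_less_measure_iff)
    also have "measure ?G {s<..t} = ?F t - ?F s"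
      using that by (intro cdf_diff_eq[symmetric]) simp
    finally show ?thesis by simp
  qed
  have zero: "?F 0 = 0" using measure_gamma_nonpos[of a b] by (simp add: cdf_def)
  have cont: "isCont ?F t" for t by (simp add: isCont_cdf measure_gamma_singleton)
  show ?thesis
    unfolding bij_betw_def
  proof
    show "inj_on ?F {0<..}"
    proof (rule inj_onI)
      fix s t assume "s \<in> {0<..}" "t \<in> {0<..}" "?F s = ?F t"
      then show "s = t"
        using strict[of s t] strict[of t s] by (cases s t rule: linorder_cases) auto
    qed
    show "?F ` {0<..} = {0<..<1}"
    proof (intro equalityI subsetI)
      fix y assume "y \<in> ?F ` {0<..}"
      then obtain t where t: "0 < t" "y = ?F t" by auto
      then show "y \<in> {0<..<1}"
        using strict[of 0 t] strict[of t "t + 1"] cdf_bounded_prob[of "t + 1"] zero by auto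
    next
      fix y :: real assume y: "y \<in> {0<..<1}"
      have "eventually (\<lambda>t. y < ?F t) at_top"
        using y by (intro order_tendstoD(1)[OF cdf_lim_at_top_prob]) auto
      then have "eventually (\<lambda>t. y < ?F t \<and> 0 < t) at_top"
        using eventually_gt_at_top[of 0] by (rule eventually_conj)
      then obtain T where T: "y < ?F T" "0 < T"
        by (auto dest: eventually_happens)
      have "\<exists>t\<ge>0. t \<le> T \<and> ?F t = y"
        using T y zero cont by (intro IVT) auto
      then obtain t where t: "0 \<le> t" "?F t = y" by auto
      then have "t \<noteq> 0" using y zero by auto
      with t show "y \<in> ?F ` {0<..}" by auto
    qed
  qed
qed

lemma gamma_cdf_inv:
  assumes "0 < a" "0 < b" "0 < p" "p < 1"
  shows "0 < gamma_cdf_inv a b p" "cdf (gamma_distribution a b) (gamma_cdf_inv a b p) = p"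
proof -
  have p: "p \<in> cdf (gamma_distribution a b) ` {0<..}"
    using bij_betw_gamma_cdf[OF assms(1,2)] assms by (simp add: bij_betw_def)
  show "0 < gamma_cdf_inv a b p"
    using inv_into_into[OF p] by (simp add: gamma_cdf_inv_def)
  show "cdf (gamma_distribution a b) (gamma_cdf_inv a b p) = p"
    using f_inv_into_f[OF p] by (simp add: gamma_cdf_inv_def)
qed

section \<open>Credible and confidence intervals\<close>

lemma gamma_credible_interval:
  assumes "0 < a" "0 < b" "0 < r" "0 < p" "p < 1"
  shows "measure (gamma_distribution a (b * r)) {0 .. gamma_cdf_inv a b p / r} = p"
  using assms gamma_cdf_inv[OF assms(1,2,4,5)]
  by (simp add: measure_gamma_Icc cdf_gamma_scale)

text \<open>The interval covers \<open>\<beta>\<close> exactly if the sum of the data is positive and at most \<open>m q / \<beta>\<close>,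
  where \<open>q\<close> is the quantile, and the probability of this event is a value of the distribution function of
  \<open>\<Gamma>(m\<alpha>, \<beta>)\<close>, which rescales to that of \<open>\<Gamma>(m\<alpha>, m)\<close> at \<open>q\<close>.\<close>
lemma (in prob_space) gamma_confidence_interval:
  assumes "0 < a" "1 \<le> m" "0 < p" "p < 1" "0 < \<beta>"
    and "indep_vars (\<lambda>_. borel) X {1..m}"
    and "\<forall>i\<in>{1..m}. distributed M lborel (X i) (\<lambda>t. ennreal (gamma_density a \<beta> t))"
  shows "prob {\<omega> \<in> space M. \<beta> \<in> {0 .. gamma_cdf_inv (real m * a) (real m) p / seq_mean m (\<lambda>i. X i \<omega>)}} = p"
proof -
  define q where "q = gamma_cdf_inv (real m * a) (real m) p"
  define S where "S = (\<lambda>\<omega>. \<Sum>i=1..m. X i \<omega>)"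
  let ?G = "gamma_distribution (real m * a) \<beta>"
  have s: "0 < real m * a" "0 < real m" using assms by auto
  note q = gamma_cdf_inv[OF s assms(3,4), folded q_def]
  have "distributed M lborel S (\<lambda>t. ennreal (gamma_density (\<Sum>i=1..m. a) \<beta> t))"
    unfolding S_def using assms by (intro distributed_gamma_sum) auto
  then have S: "distributed M lborel S (\<lambda>t. ennreal (gamma_density (real m * a) \<beta> t))"
    by simp
  have distr: "distr M lborel S = ?G"
    using distributed_distr_eq_density[OF S] by (simp add: gamma_distribution_def)
  have [measurable]: "S \<in> measurable M lborel"
    using distributed_measurable[OF S] .
  interpret G: prob_space ?G by (rule prob_space_gamma_distribution[OF s(1) assms(5)])
  have "{\<omega> \<in> space M. \<beta> \<in> {0 .. q / seq_mean m (\<lambda>i. X i \<omega>)}} =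
      S -` {0<..real m / \<beta> * q} \<inter> space M"
  proof (intro Collect_cong set_eqI)
    fix \<omega>
    have mean: "seq_mean m (\<lambda>i. X i \<omega>) = S \<omega> / real m"
      by (simp add: seq_mean_def S_def)
    have "\<beta> \<le> q / seq_mean m (\<lambda>i. X i \<omega>) \<longleftrightarrow> 0 < S \<omega> \<and> S \<omega> \<le> real m / \<beta> * q"
    proof (cases "0 < S \<omega>")
      case True
      then show ?thesis using s assms(5) by (simp add: mean field_simps)
    next
      case False
      \<comment> \<open>A nonpositive sum gives a nonpositive endpoint (with \<open>q / 0 = 0\<close>), below \<open>\<beta>\<close>.\<close>
      then have "q * real m / S \<omega> \<le> 0"
        using q s by (intro divide_nonneg_nonpos) auto
      then have "q / seq_mean m (\<lambda>i. X i \<omega>) \<le> 0"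
        by (simp add: mean)
      with assms(5) False show ?thesis by auto
    qed
    then show "\<omega> \<in> {\<omega> \<in> space M. \<beta> \<in> {0 .. q / seq_mean m (\<lambda>i. X i \<omega>)}} \<longleftrightarrow>
      \<omega> \<in> S -` {0<..real m / \<beta> * q} \<inter> space M"
      using assms(5) by auto
  qed
  then have "prob {\<omega> \<in> space M. \<beta> \<in> {0 .. q / seq_mean m (\<lambda>i. X i \<omega>)}} =
      measure ?G {0<..real m / \<beta> * q}"
    unfolding distr[symmetric] by (simp add: measure_distr[OF distributed_measurable[OF S]])
  also have "\<dots> = measure ?G ({..real m / \<beta> * q} - {..0})"
    by (rule arg_cong[where f = "measure ?G"]) auto
  also have "\<dots> = cdf ?G (real m / \<beta> * q)"
    using q s assms(5) measure_gamma_nonpos[of "real m * a" \<beta>]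
    by (subst G.finite_measure_Diff) (auto simp: cdf_def)
  also have "\<dots> = cdf (gamma_distribution (real m * a) (\<beta> * (real m / \<beta>))) q"
    using s assms(5) by (intro cdf_gamma_scale[symmetric]) auto
  also have "\<dots> = p"
    using q assms(5) by simp
  finally show ?thesis by (simp add: q_def)
qed

theorem mainTheorem6:
  fixes \<alpha> :: real
  assumes "0 < \<alpha>"
  shows
    "(\<exists>c>0. \<forall>\<beta>>0. jeffreys_prior \<alpha> \<beta> = c * (1 / \<beta>)) \<and>
     (\<forall>\<pi> \<in> {jeffreys_prior \<alpha>, (\<lambda>\<beta>. 1 / \<beta>)}.
        (\<forall>n m x. 1 \<le> m \<and> m < n \<and> (\<forall>i\<in>{1..n}. 0 < x i) \<longrightarrow>
           0 < cnml_normalizer \<alpha> n m x \<and> cnml_normalizer \<alpha> n m x < \<infinity> \<and>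
           0 < marginal \<alpha> \<pi> m x \<and> marginal \<alpha> \<pi> m x < \<infinity> \<and>
           cnml \<alpha> n m x = bayes_predictor \<alpha> \<pi> n m x) \<and>
        (\<forall>m x. 1 \<le> m \<and> (\<forall>i\<in>{1..m}. 0 < x i) \<longrightarrow>
           posterior \<alpha> \<pi> m x = gamma_distribution (real m * \<alpha>) (real m * seq_mean m x))) \<and>
     (\<forall>m a. 1 \<le> m \<and> 0 < a \<and> a < 1 \<longrightarrow>
        bij_betw (cdf (gamma_distribution (real m * \<alpha>) (real m))) {0<..} {0<..<1} \<and>
        (let q = gamma_cdf_inv (real m * \<alpha>) (real m) (1 - a) in
          (\<forall>\<pi> \<in> {jeffreys_prior \<alpha>, (\<lambda>\<beta>. 1 / \<beta>)}. \<forall>x. (\<forall>i\<in>{1..m}. 0 < x i) \<longrightarrow>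
             measure (posterior \<alpha> \<pi> m x) {0 .. q / seq_mean m x} = 1 - a \<and>
             measure (gamma_distribution (real m * \<alpha>) (real m * seq_mean m x))
               {0 .. q / seq_mean m x} = 1 - a) \<and>
          (\<forall>(M :: 'w measure) X \<beta>.
             prob_space M \<and> 0 < \<beta> \<and>
             prob_space.indep_vars M (\<lambda>_. borel) X {1..m} \<and>
             (\<forall>i\<in>{1..m}. distributed M lborel (X i) (\<lambda>t. ennreal (gamma_density \<alpha> \<beta> t))) \<longrightarrow>
             measure M {\<omega> \<in> space M. \<beta> \<in> {0 .. q / seq_mean m (\<lambda>i. X i \<omega>)}} = 1 - a)))"
proof -
  have priors: "\<exists>c>0. \<forall>\<beta>>0. \<pi> \<beta> = c * (1 / \<beta>)"
    if "\<pi> \<in> {jeffreys_prior \<alpha>, (\<lambda>\<beta>. 1 / \<beta>)}" for \<pi>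
  proof (cases "\<pi> = jeffreys_prior \<alpha>")
    case True
    then show ?thesis
      using assms jeffreys_prior_gamma by (intro exI[of _ "sqrt \<alpha>"]) simp
  next
    case False
    with that show ?thesis by (intro exI[of _ 1]) simp
  qed
  have predict: "0 < cnml_normalizer \<alpha> n m x \<and> cnml_normalizer \<alpha> n m x < \<infinity> \<and>
      0 < marginal \<alpha> \<pi> m x \<and> marginal \<alpha> \<pi> m x < \<infinity> \<and>
      cnml \<alpha> n m x = bayes_predictor \<alpha> \<pi> n m x"
    if \<pi>: "\<pi> \<in> {jeffreys_prior \<alpha>, (\<lambda>\<beta>. 1 / \<beta>)}" and mn: "1 \<le> m" "m < n"
      and x: "\<forall>i\<in>{1..n}. 0 < x i" for \<pi> n m x
  proof -
    obtain c where c: "0 < c" "\<forall>\<beta>>0. \<pi> \<beta> = c * (1 / \<beta>)" using priors[OF \<pi>] by blast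
    have xm: "\<forall>i\<in>{1..m}. 0 < x i" using x mn by auto
    have "0 < cnml_factor (real n * \<alpha>)"
      using assms mn by (intro cnml_factor_pos) simp
    then show ?thesis
      using evidence_pos[OF assms mn(1) xm] c(1)
      by (simp add: cnml_normalizer_eq[OF assms mn xm] marginal_eq[OF assms mn(1) xm c]
          cnml_eq_bayes[OF assms mn x c])
  qed
  have post: "posterior \<alpha> \<pi> m x = gamma_distribution (real m * \<alpha>) (real m * seq_mean m x)"
    if \<pi>: "\<pi> \<in> {jeffreys_prior \<alpha>, (\<lambda>\<beta>. 1 / \<beta>)}" and m: "1 \<le> m"
      and x: "\<forall>i\<in>{1..m}. 0 < x i" for \<pi> m x
    using priors[OF \<pi>] posterior_eq[OF assms m x] by blast
  have credible: "measure (gamma_distribution (real m * \<alpha>) (real m * seq_mean m x))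
      {0 .. gamma_cdf_inv (real m * \<alpha>) (real m) (1 - a) / seq_mean m x} = 1 - a"
    if "1 \<le> m" "0 < a" "a < 1" "\<forall>i\<in>{1..m}. 0 < x i" for m a x
    using that assms sum_pos_data[of m x]
    by (intro gamma_credible_interval) (auto simp: seq_mean_def)
  show ?thesis
    unfolding Let_def
  proof (intro conjI allI ballI impI)
    show "\<exists>c>0. \<forall>\<beta>>0. jeffreys_prior \<alpha> \<beta> = c * (1 / \<beta>)" by (rule priors) simp
  next
    fix m :: nat and a :: real
    assume "1 \<le> m \<and> 0 < a \<and> a < 1"
    then show "bij_betw (cdf (gamma_distribution (real m * \<alpha>) (real m))) {0<..} {0<..<1}"
      using assms by (intro bij_betw_gamma_cdf) auto
  next
    fix m :: nat and a \<beta> :: real and M :: "'w measure" and X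
    assume "1 \<le> m \<and> 0 < a \<and> a < 1"
      "prob_space M \<and> 0 < \<beta> \<and> prob_space.indep_vars M (\<lambda>_. borel) X {1..m} \<and>
       (\<forall>i\<in>{1..m}. distributed M lborel (X i) (\<lambda>t. ennreal (gamma_density \<alpha> \<beta> t)))"
    then show "measure M {\<omega> \<in> space M. \<beta> \<in> {0 ..
        gamma_cdf_inv (real m * \<alpha>) (real m) (1 - a) / seq_mean m (\<lambda>i. X i \<omega>)}} = 1 - a"
      using assms by (intro prob_space.gamma_confidence_interval) auto
  qed (use predict post credible in auto)
qed

end
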